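(* Let $A,B$ be two solid, closed, convex sets in $\mathbb{R}^n$ with $A\cap B\neq\emptyset$ that satisfy condition (C) at every point $x^*\in A\cap B$. Assume there is $\hat\kappa>0$ such that $A,B$ are $\hat\kappa$-linearly regular at every $x^*\in A\cap B$, i.e. for every $x^*\in A\cap B$ there is $\delta_{x^*}>0$ with $$d_{A\cap B}(x)\le\hat\kappa\max(d_A(x),d_B(x))\quad\forall x\in\mathcal{B}_{\delta_{x^*}}(x^* ).$$ Let $\kappa=\max(\hat\kappa,\sqrt2)$. Then the GAP algorithm $x_{k+1}=\Pi_A^{\alpha_2}\Pi_B^{\alpha_1}x_k$ with parameters $$\alpha=1,\quad\alpha_1=\alpha_2=2\left(\frac{\kappa}{\sqrt{\kappa^2-1}+1}\right)^2$$ converges to a point $x^*\in A\cap B$ R-linearly with rate $\mu$ for any $\mu\in(\gamma,1)$, where $$\gamma=\left(\frac{\sqrt{\kappa^2-1}-1}{\sqrt{\kappa^2-1}+1}\right)^2=1-4\frac{\sqrt{\kappa^2-1}}{\kappa^2+2\sqrt{\kappa^2-1}}.$$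
   Context: Solid means nonempty interior; $\Pi_C$ is the projection onto $C$, $\Pi_C^\alpha:=(1-\alpha)I+\alpha\Pi_C$; $d_C$ is the distance to $C$; $\mathcal{B}_\delta(x)$ is the closed ball. A set $\mathcal{M}$ is a $\mathcal{C}^k$-manifold around $x$ if there is an open $U\ni x$ with $\mathcal{M}\cap U=\{y:F(y)=0\}$ for a $\mathcal{C}^k$ map $F:U\to\mathbb{R}^d$ with surjective derivative throughout $U$; $T_{\mathcal{M}}(x)=\ker DF(x)$. Two manifolds satisfy the regularity assumption at $x$ if they are $\mathcal{C}^k$-smooth ($k\ge2$) around $x$, their intersection is a $\mathcal{C}^k$ manifold around $x$, and $T_{\mathcal{M}\cap\mathcal{N}}(x)=T_{\mathcal{M}}(x)\cap T_{\mathcal{N}}(x)$. Condition (C) at $x^*\in A\cap B$: at least one of (C1) $x^*\in\operatorname{bd}A\cap\operatorname{bd}B$ and $(\operatorname{bd}A,\operatorname{bd}B)$ satisfy the regularity assumption at $x^*$; (C2) $x^*\in\operatorname{int}A\cap\operatorname{bd}B$ with $\operatorname{bd}B$ a $\mathcal{C}^2$ manifold around $x^*$; (C3) $x^*\in\operatorname{bd}A\cap\operatorname{int}B$ with $\operatorname{bd}A$ a $\mathcal{C}^2$ manifold around $x^*$; (C4) $x^*\in\operatorname{int}A\cap\operatorname{int}B$. R-linear convergence with rate $\mu$: there is $C>0$ with $\|x_k-x^*\|\le C\mu^k$ for all $k$. *)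

theory Defs
  imports "HOL-Analysis.Analysis"
begin

fun ck_on :: "nat \<Rightarrow> 'a::euclidean_space set \<Rightarrow> ('a \<Rightarrow> 'b::euclidean_space) \<Rightarrow> bool" where
  "ck_on 0 U F = continuous_on U F"
| "ck_on (Suc k) U F =
     (F differentiable_on U \<and> (\<forall>i\<in>Basis. ck_on k U (\<lambda>x. frechet_derivative F (at x) i)))"

text \<open>A local defining map of M around x: an open U containing x and a C^k map
  F : U \<rightarrow> R^d, where R^d is represented by a linear subspace S of the ambient space
  (d = dim S), whose derivative is surjective onto S at every point of U, with
  M \<inter> U = F^{-1}(0).\<close>
definition manifold_rep :: "nat \<Rightarrow> 'a::euclidean_space set \<Rightarrow> 'a \<Rightarrow> 'a set \<Rightarrow> 'a set \<Rightarrow> ('a \<Rightarrow> 'a) \<Rightarrow> bool" where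
  "manifold_rep k M x U S F \<longleftrightarrow>
     open U \<and> x \<in> U \<and> subspace S \<and> ck_on k U F \<and>
     (\<forall>y\<in>U. F y \<in> S \<and> range (frechet_derivative F (at y)) = S) \<and>
     M \<inter> U = {y\<in>U. F y = 0}"

definition manifold_around :: "nat \<Rightarrow> 'a::euclidean_space set \<Rightarrow> 'a \<Rightarrow> bool" where
  "manifold_around k M x \<longleftrightarrow> (\<exists>U S F. manifold_rep k M x U S F)"

text \<open>Tangent space T_M(x) = ker DF(x) (independent of the chosen F).\<close>
definition tangent_ker :: "('a::euclidean_space \<Rightarrow> 'a) \<Rightarrow> 'a \<Rightarrow> 'a set" where
  "tangent_ker F x = {v. frechet_derivative F (at x) v = 0}"

definition regularity_assumption :: "'a::euclidean_space set \<Rightarrow> 'a set \<Rightarrow> 'a \<Rightarrow> bool" where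
  "regularity_assumption M N x \<longleftrightarrow>
     (\<exists>k\<ge>2. \<exists>U1 S1 F1 U2 S2 F2 U3 S3 F3.
        manifold_rep k M x U1 S1 F1 \<and> manifold_rep k N x U2 S2 F2 \<and>
        manifold_rep k (M \<inter> N) x U3 S3 F3 \<and>
        tangent_ker F3 x = tangent_ker F1 x \<inter> tangent_ker F2 x)"

definition condition_C :: "'a::euclidean_space set \<Rightarrow> 'a set \<Rightarrow> 'a \<Rightarrow> bool" where
  "condition_C A B x \<longleftrightarrow>
     (x \<in> frontier A \<and> x \<in> frontier B \<and> regularity_assumption (frontier A) (frontier B) x) \<or>
     (x \<in> interior A \<and> x \<in> frontier B \<and> manifold_around 2 (frontier B) x) \<or>
     (x \<in> frontier A \<and> x \<in> interior B \<and> manifold_around 2 (frontier A) x) \<or>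
     (x \<in> interior A \<and> x \<in> interior B)"

definition relaxed_proj :: "real \<Rightarrow> 'a::euclidean_space set \<Rightarrow> 'a \<Rightarrow> 'a" where
  "relaxed_proj \<alpha> C x = (1 - \<alpha>) *\<^sub>R x + \<alpha> *\<^sub>R closest_point C x"

definition gap_step :: "real \<Rightarrow> real \<Rightarrow> real \<Rightarrow> 'a::euclidean_space set \<Rightarrow> 'a set \<Rightarrow> 'a \<Rightarrow> 'a" where
  "gap_step \<alpha> \<alpha>1 \<alpha>2 A B x =
     (1 - \<alpha>) *\<^sub>R x + \<alpha> *\<^sub>R relaxed_proj \<alpha>2 A (relaxed_proj \<alpha>1 B x)"

end

theory Submission
  imports Defs
begin

text \<open>Where the boundary is a manifold, the outer unit normal is unique, and unit normals at nearby
  points converge to it. Let z_n run through all half steps,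
  let t_n be the distance of z_n to the set it is projected on next, and put b = \<alpha> - 1 = \<gamma> and
  \<beta> = sqrt \<gamma>. Fejer monotonicity gives z_n \<longrightarrow> x, and convexity alone gives the one-sided recurrence
  t_(n+2) \<le> max 0 (-(1+b) c t_(n+1) - b t_n) up to relative errors o(1), where c is the inner
  product of the two normals at x. Testing linear regularity along the sum of the normals yields
  2 \<le> \<kappa>^2 (1 + c) unless c = -1, and this is exactly -(1+b) c \<le> 2 \<beta>, i.e. the comparison recurrence has
  a nonpositive discriminant and decays faster than \<rho>^n for every \<rho> > \<beta>. If c = -1,
  linear regularity makes the sets locally complementary half spaces and t_(n+1) \<le> b t_n.
  Two half steps make one step of the algorithm, hence the rate \<mu> = \<rho>^2.\<close>

section \<open>Unit normals, smooth boundary points, first-order behaviour of the distance\<close>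

definition unit_normal :: "'a::euclidean_space set \<Rightarrow> 'a \<Rightarrow> 'a \<Rightarrow> bool" where
  "unit_normal C x u \<longleftrightarrow> norm u = 1 \<and> (\<forall>z\<in>C. u \<bullet> (z - x) \<le> 0)"

text \<open>The normal cone at x is a single ray. Smoothness of a boundary enters the convergence
  argument only in this form.\<close>

definition smooth_point :: "'a::euclidean_space set \<Rightarrow> 'a \<Rightarrow> 'a \<Rightarrow> bool" where
  "smooth_point C x n \<longleftrightarrow> unit_normal C x n \<and> (\<forall>u. unit_normal C x u \<longrightarrow> u = n)"

text \<open>A normalised supporting hyperplane. If the interior is empty, C lies in a hyperplane
  whose own normal serves; this flat case occurs in \<open>opposite_normals_disc\<close>, where the
  thickened set is not known in advance to have interior points.\<close>

lemma unit_normal_exists: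
  assumes "convex C" "x \<in> C" "x \<notin> interior C"
  shows "\<exists>u. unit_normal C x u"
proof -
  obtain a where a: "a \<noteq> 0" "\<And>y. y \<in> C \<Longrightarrow> a \<bullet> x \<le> a \<bullet> y"
  proof (cases "interior C = {}")
    case True
    then obtain a b where ab: "a \<noteq> 0" "C \<subseteq> {y. a \<bullet> y = b}"
      using empty_interior_subset_hyperplane[OF assms(1)] by metis
    then have "a \<bullet> x \<le> a \<bullet> y" if "y \<in> C" for y
      using subsetD[OF ab(2) assms(2)] subsetD[OF ab(2) that] by simp
    then show ?thesis using that ab(1) by blast
  next
    case False
    then show ?thesis
      using supporting_hyperplane_rel_boundary[OF assms(1,2)] rel_interior_nonempty_interior[OF False] 
        assms(3) that by metis
  qed
  \<comment> \<open>The inequality for a is that of an inner normal, hence the sign.\<close>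
  have "unit_normal C x (- sgn a)"
    using a by (auto simp: unit_normal_def norm_sgn sgn_div_norm inner_diff_right divide_simps)
  then show ?thesis by blast
qed

lemma unit_normal_closest_point:
  assumes "closed C" "convex C" "C \<noteq> {}" "z \<notin> C"
  shows "unit_normal C (closest_point C z) (sgn (z - closest_point C z))"
proof -
  have "z \<noteq> closest_point C z"
    using closest_point_in_set[OF assms(1,3)] assms(4) by metis
  then show ?thesis
    using closest_point_dot[OF assms(2,1), of _ z]
    by (auto simp: unit_normal_def norm_sgn sgn_div_norm divide_simps)
qed

lemma infdist_closest_point:
  fixes C :: "'a::euclidean_space set"
  assumes "closed C" "C \<noteq> {}"
  shows "infdist z C = norm (z - closest_point C z)"
  using assms by (simp add: infdist_eq_setdist setdist_closest_point dist_norm)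

lemma inner_sgn_self: "sgn v \<bullet> v = norm v"
  for v :: "'a::real_inner"
  by (cases "v = 0") (simp_all add: sgn_div_norm dot_square_norm power2_eq_square)

lemma unit_normal_tendsto:
  assumes "\<And>k. unit_normal C (w k) (u k)" "w \<longlonglongrightarrow> x" "u \<longlonglongrightarrow> v"
  shows "unit_normal C x v"
  unfolding unit_normal_def
proof (intro conjI ballI)
  have "(\<lambda>k. norm (u k)) \<longlonglongrightarrow> norm v" using assms(3) by (rule tendsto_norm)
  then show "norm v = 1" using assms(1) by (simp add: unit_normal_def LIMSEQ_const_iff)
  fix z assume z: "z \<in> C"
  have "(\<lambda>k. u k \<bullet> (z - w k)) \<longlonglongrightarrow> v \<bullet> (z - x)" by (intro tendsto_intros assms)
  then show "v \<bullet> (z - x) \<le> 0"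
    by (rule LIMSEQ_le_const2) (use assms(1) z in \<open>auto simp: unit_normal_def\<close>)
qed

text \<open>Compactness: unit normals at points tending to x that stay e away from n would have a
  cluster point, which by \<open>unit_normal_tendsto\<close> is a unit normal at x different from
  n.\<close>

lemma unit_normal_near:
  assumes "smooth_point C x n" "e > 0"
  shows "\<exists>d>0. \<forall>w u. dist w x < d \<longrightarrow> unit_normal C w u \<longrightarrow> norm (u - n) < e"
proof (rule ccontr)
  assume "\<not> ?thesis"
  then have "\<forall>k. \<exists>w u. dist w x < inverse (Suc k) \<and> unit_normal C w u \<and> norm (u - n) \<ge> e"
    by (metis inverse_positive_iff_positive not_less of_nat_0_less_iff zero_less_Suc)
  then obtain w u where wu: "\<And>k. dist (w k) x < inverse (Suc k)"
    "\<And>k. unit_normal C (w k) (u k)" "\<And>k. norm (u k - n) \<ge> e" by metis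
  have "\<And>k. u k \<in> cball 0 1" using wu(2) by (simp add: unit_normal_def)
  then obtain v r where r: "strict_mono r" "(u \<circ> r) \<longlonglongrightarrow> v"
    using compact_cball[of "0::'a" 1] unfolding compact_def by metis
  have "(\<lambda>k. dist (w k) x) \<longlonglongrightarrow> 0"
    by (rule tendsto_sandwich[OF _ _ tendsto_const LIMSEQ_inverse_real_of_nat])
      (use wu(1) in \<open>auto intro!: always_eventually less_imp_le simp del: of_nat_Suc\<close>)
  then have "w \<longlonglongrightarrow> x" by (rule tendsto_dist_iff[THEN iffD2])
  then have "(w \<circ> r) \<longlonglongrightarrow> x" using r(1) by (rule LIMSEQ_subseq_LIMSEQ)
  then have "unit_normal C x v" using unit_normal_tendsto[of C "w \<circ> r" "u \<circ> r"] wu(2) r(2) by simp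
  then have "v = n" using assms(1) by (simp add: smooth_point_def)
  moreover have "(\<lambda>k. norm ((u \<circ> r) k - n)) \<longlonglongrightarrow> norm (v - n)" by (intro tendsto_intros r)
  then have "norm (v - n) \<ge> e" by (rule LIMSEQ_le_const) (use wu(3) in auto)
  ultimately show False using assms(2) by simp
qed

text \<open>The distance of z = x + t v is the inner product of z - w with u, where w is the
  projection and u the unit normal there. As x lies in C, this is at most t times the inner product
  of u and v, and u is close to n because w is close to x.\<close>

lemma infdist_smooth_point:
  assumes "closed C" "convex C" "x \<in> C" "smooth_point C x n" "e > 0"
  shows "\<forall>\<^sub>F t in at_right (0::real). infdist (x + t *\<^sub>R v) C \<le> t * (max 0 (n \<bullet> v) + e)"
proof -
  \<comment> \<open>The summand 1 keeps the denominator positive for v = 0.\<close>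
  define e' where "e' = e / (norm v + 1)"
  have e': "e' > 0" "e' * norm v \<le> e"
    using assms(5) add_nonneg_pos[OF norm_ge_zero[of v] zero_less_one]
    by (auto simp: e'_def field_simps)
  obtain d where d: "d > 0" "\<And>w u. dist w x < d \<Longrightarrow> unit_normal C w u \<Longrightarrow> norm (u - n) < e'"
    using unit_normal_near[OF assms(4) e'(1)] by blast
  have ev: "\<forall>\<^sub>F t in at_right (0::real). 0 < t \<and> t < d / (norm v + 1)"
    unfolding eventually_at_right_field using d(1) by (intro exI[of _ "d / (norm v + 1)"]) (auto simp: add_nonneg_pos)
  show ?thesis
  proof (rule eventually_mono[OF ev])
    fix t assume t: "0 < t \<and> t < d / (norm v + 1)"
    let ?z = "x + t *\<^sub>R v"
    let ?w = "closest_point C ?z"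
    let ?u = "sgn (?z - ?w)"
    show "infdist ?z C \<le> t * (max 0 (n \<bullet> v) + e)"
    proof (cases "?z \<in> C")
      case True then show ?thesis using t assms(5) by simp
    next
      case False
      have ne: "C \<noteq> {}" using assms(3) by auto
      have un: "unit_normal C ?w ?u" using unit_normal_closest_point[OF assms(1,2) ne False] .
      have "dist ?w x \<le> dist ?z x"
        using closest_point_lipschitz[OF assms(2,1) ne, of ?z x] closest_point_self[OF assms(3)] by simp
      also have "\<dots> \<le> t * (norm v + 1)" using t by (simp add: dist_norm mult_left_mono)
      also have "\<dots> < d" using t add_nonneg_pos[OF norm_ge_zero[of v] zero_less_one] by (simp add: pos_less_divide_eq)
      finally have nu: "norm (?u - n) < e'" using d(2) un by blast
      have "infdist ?z C = ?u \<bullet> (?z - ?w)"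
        using assms(1) ne by (simp add: infdist_closest_point inner_sgn_self)
      also have "\<dots> = t * (?u \<bullet> v) + ?u \<bullet> (x - ?w)"
        by (simp add: inner_diff_right inner_add_right)
      also have "\<dots> \<le> t * (?u \<bullet> v)" using un assms(3) by (simp add: unit_normal_def)
      also have "\<dots> \<le> t * (max 0 (n \<bullet> v) + e)"
      proof (rule mult_left_mono)
        have "(?u - n) \<bullet> v \<le> norm (?u - n) * norm v" by (rule norm_cauchy_schwarz)
        also have "\<dots> \<le> e' * norm v" using nu by (intro mult_right_mono) auto
        finally show "?u \<bullet> v \<le> max 0 (n \<bullet> v) + e" using e'(2) by (simp add: inner_diff_left)
      qed (use t in simp)
      finally show ?thesis .
    qed
  qed
qed

section \<open>From a manifold boundary to a unique normal\<close>

text \<open>The segment runs from s = -1, outside C by the supporting half space, to s = 1, inside C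
  by convexity, so by connectedness it meets the frontier.\<close>

lemma frontier_on_transversal_line:
  assumes "closed C" "convex C" "x \<in> C" "unit_normal C x u"
    and ball: "ball (x + e) r \<subseteq> C" and v: "norm v < r" and t: "0 < t" "t \<le> 1"
  shows "\<exists>s\<in>{-1..1}. x + t *\<^sub>R (v + s *\<^sub>R e) \<in> frontier C"
proof -
  let ?f = "\<lambda>s. x + t *\<^sub>R (v + s *\<^sub>R e)"
  have r: "r > 0" using v norm_ge_zero[of v] by linarith
  have "x + e + v \<in> C" using ball v by (auto simp: dist_norm subset_iff)
  then have "(1 - t) *\<^sub>R x + t *\<^sub>R (x + e + v) \<in> C"
    using assms(2,3) t by (intro convexD) auto
  then have 1: "?f 1 \<in> C" by (simp add: algebra_simps)
  \<comment> \<open>With r' strictly between norm v and r, the point x + e + r' u still lies in C.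
    Hence the inner product of u and e is at most -r' < - norm v, which pushes the end s = -1
    strictly out of C.\<close>
  define r' where "r' = (norm v + r) / 2"
  have r': "norm v < r'" "r' < r" using v by (auto simp: r'_def)
  then have r'0: "0 < r'" using norm_ge_zero[of v] by linarith
  have "x + e + r' *\<^sub>R u \<in> C" using ball assms(4) r' r'0 by (auto simp: dist_norm subset_iff unit_normal_def)
  then have "u \<bullet> (x + e + r' *\<^sub>R u - x) \<le> 0" using assms(4) by (auto simp: unit_normal_def)
  then have ue: "u \<bullet> e \<le> - r'" using assms(4) by (simp add: inner_add_right unit_normal_def dot_square_norm)
  have "- (u \<bullet> v) \<le> norm v" using norm_cauchy_schwarz[of "-u" v] assms(4) by (simp add: unit_normal_def)
  then have "u \<bullet> (?f (-1) - x) > 0" using ue r'(1) t by (simp add: inner_diff_right)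
  then have 2: "?f (-1) \<notin> C" using assms(4) by (force simp: unit_normal_def)
  have "connected (?f ` {-1..1})"
    by (intro connected_continuous_image continuous_intros connected_Icc)
  then have "?f ` {-1..1} \<inter> frontier C \<noteq> {}"
  proof (rule connected_Int_frontier)
    show "?f ` {-1..1} \<inter> C \<noteq> {}"
      using 1 imageI[of "1::real" "{-1..1}" ?f] by auto
    show "?f ` {-1..1} - C \<noteq> {}"
      using 2 imageI[of "-1::real" "{-1..1}" ?f] by auto
  qed
  then show ?thesis by blast
qed

text \<open>Taking limits of frontier points on the lines parallel to an inward direction e shows that
  the kernel of the derivative contains v + s e for every v and some s; being a
  subspace that does not contain e, it is a hyperplane orthogonal to every normal.\<close>
lemma smooth_point_of_manifold:
  assumes C: "closed C" "convex C" "interior C \<noteq> {}" and x: "x \<in> frontier C"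
    and F: "manifold_rep k (frontier C) x U S F" "k > 0"
  shows "\<exists>n. smooth_point C x n"
proof -
  have U: "open U" "x \<in> U" and ck: "ck_on k U F" and FS: "range (frechet_derivative F (at x)) = S"
    "\<And>y. y \<in> U \<Longrightarrow> F y \<in> S" and FU: "frontier C \<inter> U = {y\<in>U. F y = 0}"
    using F(1) by (auto simp: manifold_rep_def)
  define L where "L = frechet_derivative F (at x)"
  have "F differentiable_on U" using ck F(2) by (cases k) auto
  then have "F differentiable (at x)"
    using U by (metis at_within_open differentiable_on_def)
  then have der: "(F has_derivative L) (at x)" unfolding L_def by (simp add: frechet_derivative_works)
  then have linL: "linear L" by (rule has_derivative_linear)
  have F0: "F y = 0" if "y \<in> frontier C" "y \<in> U" for y using FU that by blast
  have xC: "x \<in> C" using x C(1) by (simp add: frontier_def)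
  obtain p where p: "p \<in> interior C" using C(3) by blast
  define e where "e = p - x"
  obtain r where r: "r > 0" "ball (x + e) r \<subseteq> C" using p by (auto simp: e_def mem_interior)
  obtain u0 where u0: "unit_normal C x u0"
    using unit_normal_exists[OF C(2) xC] x C(1) by (auto simp: frontier_def)
  \<comment> \<open>Every short v becomes a tangent vector after a shift along e, and as a limit of
    directions into C it has nonpositive inner product with every normal.\<close>
  have tangent: "\<exists>s. L (v + s *\<^sub>R e) = 0 \<and> (\<forall>u. unit_normal C x u \<longrightarrow> u \<bullet> (v + s *\<^sub>R e) \<le> 0)"
    if v: "norm v < r" for v
  proof -
    define t :: "nat \<Rightarrow> real" where "t k = inverse (Suc k)" for k
    have t: "0 < t k" "t k \<le> 1" for k by (auto simp: t_def divide_simps)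
    have t0: "t \<longlonglongrightarrow> 0" unfolding t_def by (rule LIMSEQ_inverse_real_of_nat)
    obtain s where s: "\<And>k. s k \<in> {-1..1}" "\<And>k. x + t k *\<^sub>R (v + s k *\<^sub>R e) \<in> frontier C"
      using frontier_on_transversal_line[OF C(1,2) xC u0 r(2) v t] by metis
    obtain l q where q: "strict_mono q" "(s \<circ> q) \<longlonglongrightarrow> l"
      using compact_Icc[of "-1::real" 1] s(1) unfolding compact_def by metis
    define a where "a k = v + s (q k) *\<^sub>R e" for k
    have tq0: "(\<lambda>k. t (q k)) \<longlonglongrightarrow> 0" using LIMSEQ_subseq_LIMSEQ[OF t0 q(1)] by (simp add: o_def)
    have a: "a \<longlonglongrightarrow> v + l *\<^sub>R e"
      unfolding a_def using q(2) by (intro tendsto_intros) (simp add: o_def)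
    have fr: "x + t (q k) *\<^sub>R a k \<in> frontier C" for k using s(2) by (simp add: a_def)
    have "(\<lambda>k. x + t (q k) *\<^sub>R a k) \<longlonglongrightarrow> x + 0 *\<^sub>R (v + l *\<^sub>R e)"
      by (intro tendsto_intros tq0 a)
    then have lim: "(\<lambda>k. x + t (q k) *\<^sub>R a k) \<longlonglongrightarrow> x" by simp
    have evU: "\<forall>\<^sub>F k in sequentially. x + t (q k) *\<^sub>R a k \<in> U"
      using topological_tendstoD[OF lim U] .
    \<comment> \<open>F vanishes at x and at x + t a, so norm (L a) is the relative
      differentiability remainder times norm a.\<close>
    have small: "(\<lambda>k. norm (L (a k))) \<longlonglongrightarrow> 0"
    proof (rule tendsto_0_le[where K=1])
      let ?R = "\<lambda>y. norm (F y - F x - L (y - x)) / norm (y - x)"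
      have R: "(?R \<longlongrightarrow> 0) (at x)" using der by (simp add: has_derivative_iff_norm)
      \<comment> \<open>The quotient is continued by 0 since a k may vanish and the sequence may hit
        x.\<close>
      define G where "G y = (if y = x then 0 else ?R y)" for y
      have "isCont G x" using R unfolding isCont_def G_def
        by (subst LIM_equal[of x _ ?R]) auto
      then have "(\<lambda>k. G (x + t (q k) *\<^sub>R a k)) \<longlonglongrightarrow> 0"
        using isCont_tendsto_compose[OF _ lim, of G] by (simp add: G_def)
      then show "(\<lambda>k. G (x + t (q k) *\<^sub>R a k) * norm (a k)) \<longlonglongrightarrow> 0"
        using tendsto_mult[OF _ tendsto_norm[OF a]] by fastforce
      show "\<forall>\<^sub>F k in sequentially. norm (norm (L (a k))) \<le> norm (G (x + t (q k) *\<^sub>R a k) * norm (a k)) * 1"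
      proof (rule eventually_mono[OF evU])
        fix k assume kU: "x + t (q k) *\<^sub>R a k \<in> U"
        show "norm (norm (L (a k))) \<le> norm (G (x + t (q k) *\<^sub>R a k) * norm (a k)) * 1"
        proof (cases "a k = 0")
          case True then show ?thesis using linL by (simp add: linear_0)
        next
          case False
          then show ?thesis
            using F0[OF fr kU] F0[OF x U(2)] t[of "q k"] linL by (simp add: G_def linear_cmul)
        qed
      qed
    qed
    have "(\<lambda>k. norm (L (a k))) \<longlonglongrightarrow> norm (L (v + l *\<^sub>R e))"
      using linear_continuous_at[OF linear_conv_bounded_linear[THEN iffD1, OF linL]] a
      by (intro tendsto_norm isCont_tendsto_compose[of _ L])
    then have "L (v + l *\<^sub>R e) = 0" using LIMSEQ_unique[OF small] by fastforce
    moreover have "u \<bullet> (v + l *\<^sub>R e) \<le> 0" if u: "unit_normal C x u" for u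
    proof -
      have "(\<lambda>k. u \<bullet> a k) \<longlonglongrightarrow> u \<bullet> (v + l *\<^sub>R e)" by (intro tendsto_intros a)
      moreover have "u \<bullet> a k \<le> 0" for k
      proof -
        have "x + t (q k) *\<^sub>R a k \<in> C" using fr[of k] C(1) frontier_subset_closed by blast
        then have "u \<bullet> (x + t (q k) *\<^sub>R a k - x) \<le> 0" using u unfolding unit_normal_def by blast
        then show ?thesis using t(1)[of "q k"] by (simp add: mult_le_0_iff)
      qed
      ultimately show ?thesis using LIMSEQ_le_const2[of "\<lambda>k. u \<bullet> a k"] by blast
    qed
    ultimately show ?thesis by blast
  qed
  \<comment> \<open>If e were in the kernel, so would be every direction. Then S is trivial, F
    vanishes on U, and U lies in the frontier, which makes x an interior point of C.\<close>
  have Le: "L e \<noteq> 0"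
  proof
    assume Le: "L e = 0"
    have "L v = 0" for v
    proof -
      define v' where "v' = (r / (2 * (norm v + 1))) *\<^sub>R v"
      have "norm v' = r * (norm v / (2 * (norm v + 1)))" using r(1) by (simp add: v'_def)
      also have "\<dots> < r * 1"
      proof (rule mult_strict_left_mono[OF _ r(1)])
        have "2 * (norm v + 1) > 0" "norm v < 2 * (norm v + 1)" using norm_ge_zero[of v] by (simp_all only: distrib_left_numeral)
        then show "norm v / (2 * (norm v + 1)) < 1" by (simp only: pos_divide_less_eq mult_1)
      qed
      finally obtain s where "L (v' + s *\<^sub>R e) = 0" using tangent by auto
      then have "L v' = 0" using linL Le by (simp add: linear_add linear_cmul)
      moreover have "r / (2 * (norm v + 1)) \<noteq> 0" using r(1) add_nonneg_pos[OF norm_ge_zero[of v] zero_less_one] by simp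
      ultimately show ?thesis using linL by (simp add: v'_def linear_cmul)
    qed
    then have "S \<subseteq> {0}" using FS(1) by (auto simp: L_def)
    then have "U \<subseteq> frontier C" using FS(2) FU by blast
    then have "U \<subseteq> C" using C(1) frontier_subset_closed by blast
    then have "x \<in> interior C" using U by (auto intro: interiorI)
    then show False using x by (simp add: frontier_def)
  qed
  have "u = u0" if u: "unit_normal C x u" for u
  proof -
    have neg: "w \<bullet> e < 0" if "unit_normal C x w" for w
    proof -
      have "x + e + (r/2) *\<^sub>R w \<in> C" using r that by (auto simp: dist_norm subset_iff unit_normal_def)
      then have "w \<bullet> (x + e + (r/2) *\<^sub>R w - x) \<le> 0" using that by (auto simp: unit_normal_def)
      then show ?thesis using that r(1) by (simp add: inner_add_right unit_normal_def dot_square_norm)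
    qed
    have ue: "u \<bullet> e < 0" "u0 \<bullet> e < 0" using neg u u0 by auto
    \<comment> \<open>Applying \<open>tangent\<close> to v and -v and adding leaves (s + s') e in
      the kernel, so s' = -s. The paired inequalities then become equalities with one s for both u
      and u0.\<close>
    have *: "(u \<bullet> v) * (u0 \<bullet> e) = (u0 \<bullet> v) * (u \<bullet> e)" if v: "norm v < r" for v
    proof -
      obtain s where s: "L (v + s *\<^sub>R e) = 0" "u \<bullet> (v + s *\<^sub>R e) \<le> 0" "u0 \<bullet> (v + s *\<^sub>R e) \<le> 0"
        using tangent[OF v] u u0 by blast
      obtain s' where s': "L (- v + s' *\<^sub>R e) = 0" "u \<bullet> (- v + s' *\<^sub>R e) \<le> 0" "u0 \<bullet> (- v + s' *\<^sub>R e) \<le> 0"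
        using tangent[of "-v"] v u u0 by auto
      have "L ((v + s *\<^sub>R e) + (- v + s' *\<^sub>R e)) = 0"
        using s(1) s'(1) by (subst linear_add[OF linL]) simp
      then have "L ((s + s') *\<^sub>R e) = 0" by (simp add: algebra_simps)
      then have "s' = - s" using Le linL by (auto simp: linear_cmul)
      then have "u \<bullet> v = - s * (u \<bullet> e)" "u0 \<bullet> v = - s * (u0 \<bullet> e)"
        using s s' by (auto simp: inner_add_right inner_diff_right)
      then show ?thesis by simp
    qed
    \<comment> \<open>Its inner product with v is the difference of the two sides of
      \<open>*\<close>; testing with a short multiple of w itself gives w = 0. So u and u0 are
      parallel, and both are negative on e.\<close>
    define w where "w = (u0 \<bullet> e) *\<^sub>R u - (u \<bullet> e) *\<^sub>R u0"
    have "w = 0"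
    proof (rule ccontr)
      assume w: "w \<noteq> 0"
      have "norm ((r / (2 * norm w)) *\<^sub>R w) < r" using w r(1) by simp
      from *[OF this] have "w \<bullet> w = 0" using w r(1) by (simp add: w_def inner_diff_left mult.commute)
      then show False using w by simp
    qed
    then have eq: "(u0 \<bullet> e) *\<^sub>R u = (u \<bullet> e) *\<^sub>R u0" by (simp add: w_def)
    then have "norm ((u0 \<bullet> e) *\<^sub>R u) = norm ((u \<bullet> e) *\<^sub>R u0)" by simp
    then have "u0 \<bullet> e = u \<bullet> e" using u u0 ue by (simp add: unit_normal_def)
    then have "(u \<bullet> e) *\<^sub>R u = (u \<bullet> e) *\<^sub>R u0" using eq by simp
    then show ?thesis using ue(1) by (simp only: scaleR_cancel_left) simp
  qed
  then show ?thesis using u0 unfolding smooth_point_def by blast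
qed

section \<open>Linear regularity and the angle between the two normals\<close>

text \<open>Move from x by t m. The distance to the intersection is at least t times norm m, since m
  is normal to it; the distances to A and B are controlled to first order by
  \<open>infdist_smooth_point\<close>. Divide the regularity inequality by t.\<close>

lemma regularity_bound_normal:
  assumes A: "closed A" "convex A" "x \<in> A" "smooth_point A x n1"
    and B: "closed B" "convex B" "x \<in> B" "smooth_point B x n2"
    and \<kappa>: "\<kappa> > 0" "\<delta> > 0"
      "\<And>y. y \<in> cball x \<delta> \<Longrightarrow> infdist y (A \<inter> B) \<le> \<kappa> * max (infdist y A) (infdist y B)"
    and m: "\<And>z. z \<in> A \<inter> B \<Longrightarrow> m \<bullet> (z - x) \<le> 0"
  shows "norm m \<le> \<kappa> * max 0 (max (n1 \<bullet> m) (n2 \<bullet> m))"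
proof -
  let ?M = "max 0 (max (n1 \<bullet> m) (n2 \<bullet> m))"
  have "norm m \<le> \<kappa> * ?M + e" if e: "e > 0" for e
  proof -
    have ek: "e / \<kappa> > 0" using e \<kappa> by simp
    have np: "norm m + 1 > 0" by (simp add: add_nonneg_pos)
    \<comment> \<open>The bound on t keeps x + t m in the ball where regularity is
      available.\<close>
    have "\<forall>\<^sub>F t in at_right (0::real). 0 < t \<and> t < \<delta> / (norm m + 1)"
      unfolding eventually_at_right_field using \<kappa>(2) np by (intro exI[of _ "\<delta> / (norm m + 1)"]) auto
    moreover have "\<forall>\<^sub>F t in at_right (0::real).
        infdist (x + t *\<^sub>R m) A \<le> t * (max 0 (n1 \<bullet> m) + e / \<kappa>) \<and>
        infdist (x + t *\<^sub>R m) B \<le> t * (max 0 (n2 \<bullet> m) + e / \<kappa>)"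
      by (intro eventually_conj infdist_smooth_point A B ek)
    ultimately have "\<forall>\<^sub>F t in at_right (0::real). (0 < t \<and> t < \<delta> / (norm m + 1)) \<and>
        infdist (x + t *\<^sub>R m) A \<le> t * (max 0 (n1 \<bullet> m) + e / \<kappa>) \<and>
        infdist (x + t *\<^sub>R m) B \<le> t * (max 0 (n2 \<bullet> m) + e / \<kappa>)"
      by (rule eventually_conj)
    then obtain t where t: "0 < t" "t < \<delta> / (norm m + 1)"
        "infdist (x + t *\<^sub>R m) A \<le> t * (max 0 (n1 \<bullet> m) + e / \<kappa>)"
        "infdist (x + t *\<^sub>R m) B \<le> t * (max 0 (n2 \<bullet> m) + e / \<kappa>)"
      using eventually_happens'[OF trivial_limit_at_right_real] by blast
    have "t * norm m \<le> t * (norm m + 1)" using t(1) by (simp add: mult_left_mono)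
    also have "\<dots> < \<delta>" using t(2) np by (simp add: pos_less_divide_eq)
    finally have cb: "x + t *\<^sub>R m \<in> cball x \<delta>" using t(1) by (simp add: dist_norm)
    have "t * norm m \<le> infdist (x + t *\<^sub>R m) (A \<inter> B)"
    proof -
      have "t * norm m \<le> dist (x + t *\<^sub>R m) z" if z: "z \<in> A \<inter> B" for z
      proof (cases "m = 0")
        case False
        have "t * norm m * norm m \<le> m \<bullet> (t *\<^sub>R m) - m \<bullet> (z - x)"
          using m[OF z] by (simp add: dot_square_norm power2_eq_square)
        also have "\<dots> = m \<bullet> (x + t *\<^sub>R m - z)" by (simp add: inner_diff_right inner_add_right)
        also have "\<dots> \<le> norm m * norm (x + t *\<^sub>R m - z)" by (rule norm_cauchy_schwarz)
        finally show ?thesis using False by (simp add: dist_norm mult.commute)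
      qed simp
      then show ?thesis
        using A(3) B(3) by (auto simp: infdist_def intro!: cINF_greatest)
    qed
    also have "\<dots> \<le> \<kappa> * max (infdist (x + t *\<^sub>R m) A) (infdist (x + t *\<^sub>R m) B)"
      using \<kappa>(3) cb by blast
    also have "\<dots> \<le> \<kappa> * (t * (?M + e / \<kappa>))"
    proof (intro mult_left_mono max.boundedI)
      show "infdist (x + t *\<^sub>R m) A \<le> t * (?M + e / \<kappa>)"
        by (rule order_trans[OF t(3)]) (use t(1) in \<open>auto intro!: mult_left_mono\<close>)
      show "infdist (x + t *\<^sub>R m) B \<le> t * (?M + e / \<kappa>)"
        by (rule order_trans[OF t(4)]) (use t(1) in \<open>auto intro!: mult_left_mono\<close>)
    qed (use \<kappa> in simp)
    also have "\<dots> = t * (\<kappa> * ?M + e)" using \<kappa>(1) by (simp add: algebra_simps)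
    finally show ?thesis using t(1) by simp
  qed
  then show ?thesis by (rule field_le_epsilon)
qed

text \<open>Take m = n1 + n2, a normal of the intersection. Its square norm is 2 (1 + c), where c is
  the inner product of n1 and n2, and its inner product with either normal is 1 + c. Squaring and
  cancelling 1 + c > 0 gives the claim.\<close>

lemma regularity_angle_bound:
  assumes "closed A" "convex A" "x \<in> A" "smooth_point A x n1"
    and "closed B" "convex B" "x \<in> B" "smooth_point B x n2"
    and "\<kappa> > 0" "\<delta> > 0"
      "\<And>y. y \<in> cball x \<delta> \<Longrightarrow> infdist y (A \<inter> B) \<le> \<kappa> * max (infdist y A) (infdist y B)"
    and ne: "n1 + n2 \<noteq> 0"
  shows "2 \<le> \<kappa>\<^sup>2 * (1 + n1 \<bullet> n2)"
proof -
  have n: "unit_normal A x n1" "unit_normal B x n2" using assms by (auto simp: smooth_point_def)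
  then have n1: "n1 \<bullet> n1 = 1" "n2 \<bullet> n2 = 1" by (auto simp: unit_normal_def dot_square_norm)
  have sq: "(norm (n1 + n2))\<^sup>2 = 2 * (1 + n1 \<bullet> n2)"
    using n1 by (simp add: power2_norm_eq_inner inner_add_left inner_add_right inner_commute)
  then have pos: "1 + n1 \<bullet> n2 > 0" using ne by (metis zero_less_norm_iff zero_less_power2 less_irrefl mult_pos_pos zero_less_mult_pos zero_less_numeral)
  have "norm (n1 + n2) \<le> \<kappa> * max 0 (max (n1 \<bullet> (n1 + n2)) (n2 \<bullet> (n1 + n2)))"
    by (rule regularity_bound_normal[OF assms(1-11)])
      (use n in \<open>auto simp: unit_normal_def inner_add_left add_nonpos_nonpos\<close>)
  also have "\<dots> = \<kappa> * (1 + n1 \<bullet> n2)"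
    using n1 pos by (simp add: inner_add_right inner_commute add.commute)
  finally have "(norm (n1 + n2))\<^sup>2 \<le> (\<kappa> * (1 + n1 \<bullet> n2))\<^sup>2" by (rule power_mono) simp
  then have "2 * (1 + n1 \<bullet> n2) \<le> (\<kappa>\<^sup>2 * (1 + n1 \<bullet> n2)) * (1 + n1 \<bullet> n2)"
    unfolding sq by (simp add: power2_eq_square algebra_simps)
  then show ?thesis using pos by (rule mult_right_le_imp_le)
qed

text \<open>Thicken the intersection, translated to the origin, by the line spanned by n1 to a convex set K:
  a normal of K at 0 would contradict linear regularity, so 0 is an interior point of K.\<close>
lemma opposite_normals_disc:
  assumes A: "closed A" "convex A" "x \<in> A" "smooth_point A x n1"
    and B: "closed B" "convex B" "x \<in> B" "smooth_point B x n2"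
    and \<kappa>: "\<kappa> > 0" "\<delta> > 0"
      "\<And>y. y \<in> cball x \<delta> \<Longrightarrow> infdist y (A \<inter> B) \<le> \<kappa> * max (infdist y A) (infdist y B)"
    and opp: "n1 + n2 = 0"
  shows "\<exists>r>0. \<forall>h. n1 \<bullet> h = 0 \<longrightarrow> norm h < r \<longrightarrow> x + h \<in> A \<inter> B"
proof -
  have n2: "n2 = - n1" using opp by (simp add: eq_neg_iff_add_eq_0 add.commute)
  have n: "unit_normal A x n1" "unit_normal B x (- n1)" using A B n2 by (auto simp: smooth_point_def)
  \<comment> \<open>The two supporting half spaces are opposite, so the intersection lies in their
    common hyperplane.\<close>
  have nz: "n1 \<bullet> (z - x) = 0" if "z \<in> A \<inter> B" for z
    using n that by (force simp: unit_normal_def)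
  define K where "K = (\<lambda>(z, s). (z - x) + s *\<^sub>R n1) ` ((A \<inter> B) \<times> (UNIV :: real set))"
  have "convex K"
  proof -
    have "K = (\<lambda>y. -x + y) ` ((\<lambda>(z, s). z + s *\<^sub>R n1) ` ((A \<inter> B) \<times> UNIV))"
      unfolding K_def image_image by (intro image_cong) (auto simp: algebra_simps)
    moreover have "linear (\<lambda>(z, s). z + s *\<^sub>R n1)"
      by (rule linearI) (auto simp: algebra_simps)
    ultimately show ?thesis
      using A(2) B(2) by (simp only: convex_translation_eq convex_linear_image convex_Times convex_Int convex_UNIV)
  qed
  moreover have K: "(z - x) + s *\<^sub>R n1 \<in> K" if "z \<in> A \<inter> B" for z s
    unfolding K_def using that by force
  moreover have "0 \<in> K" using K[of x 0] A(3) B(3) by simp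
  ultimately have "0 \<in> interior K \<or> (\<exists>m. unit_normal K 0 m)" using unit_normal_exists by blast
  moreover have False if m: "unit_normal K 0 m" for m
  proof -
    have mK: "m \<bullet> y \<le> 0" if "y \<in> K" for y using m that by (auto simp: unit_normal_def)
    \<comment> \<open>K contains the whole line along n1, so m is orthogonal to n1 and n2, and the
      regularity bound forces m = 0.\<close>
    have "m \<bullet> (s *\<^sub>R n1) \<le> 0" for s using mK K[of x s] A(3) B(3) by fastforce
    from this[of 1] this[of "-1"] have mn: "m \<bullet> n1 = 0" by simp
    have "norm m \<le> \<kappa> * max 0 (max (n1 \<bullet> m) (n2 \<bullet> m))"
    proof (rule regularity_bound_normal[OF A B \<kappa>])
      fix z assume "z \<in> A \<inter> B"
      then show "m \<bullet> (z - x) \<le> 0" using mK K[of z 0] by simp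
    qed
    then show False using mn m by (simp add: n2 unit_normal_def inner_commute)
  qed
  ultimately obtain r where r: "r > 0" "ball 0 r \<subseteq> K" by (auto simp: mem_interior)
  have "x + h \<in> A \<inter> B" if h: "n1 \<bullet> h = 0" "norm h < r" for h
  proof -
    have "h \<in> K" using r(2) h(2) by auto
    then obtain z s where zs: "z \<in> A \<inter> B" "h = (z - x) + s *\<^sub>R n1" unfolding K_def by auto
    have "n1 \<bullet> h = n1 \<bullet> (z - x) + s * (n1 \<bullet> n1)" unfolding zs(2) by (simp add: inner_add_right)
    then have "s = 0" using h(1) nz[OF zs(1)] n(1) by (auto simp: unit_normal_def)
    then show ?thesis using zs by simp
  qed
  then show ?thesis using r(1) by blast
qed

text \<open>Write w - x = h + s n1 with h orthogonal to n1 and s <= 0. The point x + h lies in the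
  flat disc of \<open>opposite_normals_disc\<close>, hence in A. A normal u at w close to n1 then
  excludes s < 0, so w = x + h lies in B.\<close>

lemma opposite_normals_frontier:
  assumes A: "closed A" "convex A" "x \<in> A" "smooth_point A x n1"
    and B: "closed B" "convex B" "x \<in> B" "smooth_point B x n2"
    and \<kappa>: "\<kappa> > 0" "\<delta> > 0"
      "\<And>y. y \<in> cball x \<delta> \<Longrightarrow> infdist y (A \<inter> B) \<le> \<kappa> * max (infdist y A) (infdist y B)"
    and opp: "n1 + n2 = 0"
  shows "\<exists>d>0. \<forall>w u. w \<in> A \<longrightarrow> dist w x < d \<longrightarrow> unit_normal A w u \<longrightarrow> w \<in> B"
proof -
  obtain r where r: "r > 0" "\<And>h. n1 \<bullet> h = 0 \<Longrightarrow> norm h < r \<Longrightarrow> x + h \<in> A \<inter> B"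
    using opposite_normals_disc[OF assms] by blast
  obtain d where d: "d > 0" "\<And>w u. dist w x < d \<Longrightarrow> unit_normal A w u \<Longrightarrow> norm (u - n1) < 1"
    using unit_normal_near[OF A(4) zero_less_one] by blast
  have n1: "unit_normal A x n1" using A(4) by (simp add: smooth_point_def)
  then have n11: "n1 \<bullet> n1 = 1" by (simp add: unit_normal_def dot_square_norm)
  have "w \<in> B" if w: "w \<in> A" "dist w x < min d r" "unit_normal A w u" for w u
  proof -
    have "norm (u - n1) < 1" using d w by auto
    then have "(norm (u - n1))\<^sup>2 < 1" by (simp add: power_less_one_iff)
    moreover have "(norm (u - n1))\<^sup>2 = 2 - 2 * (u \<bullet> n1)"
      using n11 w(3) by (simp add: power2_norm_eq_inner inner_diff_left inner_diff_right inner_commute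
          unit_normal_def norm_eq_1)
    ultimately have un: "u \<bullet> n1 > 0" by simp
    define s where "s = n1 \<bullet> (w - x)"
    define h where "h = (w - x) - s *\<^sub>R n1"
    have s: "s \<le> 0" using n1 w(1) by (simp add: s_def unit_normal_def)
    have nh: "n1 \<bullet> h = 0" by (simp add: h_def inner_diff_right s_def n11)
    have "(norm h)\<^sup>2 + s\<^sup>2 = (norm (w - x))\<^sup>2"
      unfolding power2_norm_eq_inner h_def
      by (simp add: inner_diff_left inner_diff_right inner_commute s_def n11 power2_eq_square)
    then have "(norm h)\<^sup>2 \<le> (norm (w - x))\<^sup>2" by (smt (verit) zero_le_power2)
    then have "norm h < r" using w(2) by (simp add: dist_norm)
    then have xh: "x + h \<in> A" "x + h \<in> B" using r(2)[OF nh] by auto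
    have "u \<bullet> (x + h - w) \<le> 0" using w(3) xh(1) by (simp add: unit_normal_def)
    then have "- s * (u \<bullet> n1) \<le> 0" by (simp add: h_def inner_diff_right inner_add_right)
    then have "s = 0" using s un by (simp add: zero_le_mult_iff)
    then show ?thesis using xh(2) by (simp add: h_def)
  qed
  then show ?thesis using d(1) r(1) by (intro exI[of _ "min d r"]) auto
qed

section \<open>Geometric decay from scalar recurrences\<close>

lemma geometric_bound_extend:
  fixes t :: "nat \<Rightarrow> real"
  assumes "\<And>n. t n \<ge> 0" "0 < \<rho>" "\<And>n. n \<ge> N \<Longrightarrow> t n \<le> K * \<rho> ^ n"
  shows "\<exists>K\<ge>0. \<forall>n. t n \<le> K * \<rho> ^ n"
proof (intro exI conjI allI)
  let ?K = "\<bar>K\<bar> + (\<Sum>i<N. t i / \<rho> ^ i)"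
  have s0: "0 \<le> (\<Sum>i<N. t i / \<rho> ^ i)" using assms by (intro sum_nonneg) auto
  then show "0 \<le> ?K" by simp
  fix n
  have "t n / \<rho> ^ n \<le> ?K"
  proof (cases "n < N")
    case True
    then have "t n / \<rho> ^ n \<le> (\<Sum>i<N. t i / \<rho> ^ i)"
      using assms(1,2) by (intro member_le_sum) auto
    then show ?thesis by simp
  next
    case False
    then have "t n / \<rho> ^ n \<le> K" using assms(2,3) by (simp add: divide_simps)
    then show ?thesis using s0 by simp
  qed
  then show "t n \<le> ?K * \<rho> ^ n" using assms(2) by (simp add: divide_simps)
qed

text \<open>With \<sigma> = b/\<rho>, the defect t (n+1) - \<rho> t n contracts by the factor \<sigma> < \<rho>; complex characteristic
  roots of modulus below \<rho> are thereby handled without ever solving the recurrence.\<close>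
lemma three_term_decay:
  fixes t :: "nat \<Rightarrow> real"
  assumes t0: "\<And>n. t n \<ge> 0" and \<rho>: "0 < \<rho>" and b: "0 \<le> b" "b < \<rho>\<^sup>2" and a: "a \<le> \<rho> + b / \<rho>"
    and rec: "\<And>n. n \<ge> N \<Longrightarrow> t (Suc (Suc n)) \<le> max 0 (a * t (Suc n) - b * t n)"
  shows "\<exists>K\<ge>0. \<forall>n. t n \<le> K * \<rho> ^ n"
proof -
  define \<sigma> where "\<sigma> = b / \<rho>"
  have \<sigma>: "0 \<le> \<sigma>" "\<sigma> < \<rho>" "b = \<rho> * \<sigma>"
    using b \<rho> by (auto simp: \<sigma>_def divide_simps power2_eq_square)
  define s where "s n = t (N + n)" for n
  \<comment> \<open>Clipping at 0 covers the case where the recurrence only gives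
    \<open>s (Suc (Suc n))\<close> = 0: the defect is then nonpositive.\<close>
  define K where "K = max 0 (s 1 - \<rho> * s 0)"
  have K0: "K \<ge> 0" by (simp add: K_def)
  have defect: "s (Suc n) - \<rho> * s n \<le> K * \<sigma> ^ n" for n
  proof (induction n)
    case (Suc n)
    have p: "0 \<le> K * \<sigma> ^ Suc n" using K0 \<sigma> by simp
    have "s (Suc (Suc n)) \<le> max 0 (a * s (Suc n) - b * s n)" using rec[of "N + n"] by (simp add: s_def)
    moreover have "a * s (Suc n) \<le> (\<rho> + \<sigma>) * s (Suc n)"
      using a t0 by (intro mult_right_mono) (auto simp: s_def \<sigma>_def)
    moreover have "\<sigma> * (s (Suc n) - \<rho> * s n) \<le> \<sigma> * (K * \<sigma> ^ n)"
      using Suc \<sigma> by (intro mult_left_mono) auto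
    moreover have "0 \<le> \<rho> * s (Suc n)" using \<rho> t0 by (simp add: s_def)
    ultimately show ?case using p \<sigma>(3) by (simp add: max_def algebra_simps split: if_splits)
  qed (simp add: K_def)
  \<comment> \<open>Chosen so that -D \<sigma>^n solves the equation s (n+1) = \<rho> s n + K
    \<sigma>^n.\<close>
  define D where "D = K / (\<rho> - \<sigma>)"
  have D: "D * (\<rho> - \<sigma>) = K" "D \<ge> 0" using \<sigma>(2) K0 by (auto simp: D_def)
  have bound: "s n \<le> (s 0 + D) * \<rho> ^ n - D * \<sigma> ^ n" for n
  proof (induction n)
    case (Suc n)
    have "s (Suc n) \<le> \<rho> * s n + K * \<sigma> ^ n" using defect[of n] by simp
    also have "\<dots> \<le> \<rho> * ((s 0 + D) * \<rho> ^ n - D * \<sigma> ^ n) + K * \<sigma> ^ n"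
      using Suc \<rho> by (intro add_right_mono mult_left_mono) auto
    also have "\<dots> = (s 0 + D) * \<rho> ^ Suc n - D * \<sigma> ^ Suc n" unfolding D(1)[symmetric] by (simp add: algebra_simps)
    finally show ?case .
  qed simp
  show ?thesis
  proof (rule geometric_bound_extend[OF t0 \<rho>])
    fix n assume n: "n \<ge> N"
    have "t n = s (n - N)" using n by (simp add: s_def)
    also have "\<dots> \<le> (s 0 + D) * \<rho> ^ (n - N)" using bound[of "n - N"] D(2) \<sigma>(1) by (smt (verit) mult_nonneg_nonneg zero_le_power)
    also have "\<dots> = (s 0 + D) / \<rho> ^ N * \<rho> ^ n" using \<rho> n by (simp add: power_diff)
    finally show "t n \<le> (s 0 + D) / \<rho> ^ N * \<rho> ^ n" .
  qed
qed

section \<open>Normals and angles near a smooth or interior point\<close>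

text \<open>Points near an interior point carry no unit normal, so that case is vacuous and can be
  treated together with the smooth one.\<close>

lemma unit_normal_near_or_interior:
  assumes "x \<in> interior C \<or> smooth_point C x n" "e > 0"
  shows "\<exists>d>0. \<forall>w u. dist w x < d \<longrightarrow> unit_normal C w u \<longrightarrow> x \<notin> interior C \<and> norm (u - n) < e"
proof (cases "x \<in> interior C")
  case True
  then obtain r where r: "r > 0" "ball x r \<subseteq> C" by (auto simp: mem_interior)
  have "\<not> unit_normal C w u" if w: "dist w x < r / 2" for w u
  proof
    assume u: "unit_normal C w u"
    have "dist x (w + (r / 2) *\<^sub>R u) \<le> dist x w + norm ((r/2) *\<^sub>R u)"
      by (metis dist_norm dist_triangle add_diff_cancel_left' dist_commute)
    then have "w + (r / 2) *\<^sub>R u \<in> C"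
      using w u r by (auto simp: unit_normal_def dist_commute subset_iff)
    then have "u \<bullet> (w + (r / 2) *\<^sub>R u - w) \<le> 0" using u unfolding unit_normal_def by blast
    then show False using u r(1) by (simp add: unit_normal_def dot_square_norm)
  qed
  then show ?thesis using r(1) by (intro exI[of _ "r / 2"]) auto
next
  case False
  then show ?thesis using unit_normal_near[of C x n e] assms by auto
qed

lemma inner_unit_vectors_near:
  fixes u v m m' :: "'a::real_inner"
  assumes "norm u = 1" "norm m' = 1" "norm (u - m) < e" "norm (v - m') < e" "norm v = 1"
  shows "\<bar>u \<bullet> v - m \<bullet> m'\<bar> \<le> 2 * e"
proof -
  have "u \<bullet> v - m \<bullet> m' = u \<bullet> (v - m') + (u - m) \<bullet> m'" by (simp add: inner_diff_left inner_diff_right)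
  moreover have "\<bar>u \<bullet> (v - m')\<bar> \<le> e" "\<bar>(u - m) \<bullet> m'\<bar> \<le> e"
    using Cauchy_Schwarz_ineq2[of u "v - m'"] Cauchy_Schwarz_ineq2[of "u - m" m'] assms by auto
  ultimately show ?thesis by linarith
qed

section \<open>Half steps of alternating relaxed projections\<close>

text \<open>Alternation is a family of period two, so projecting onto either set is one rule indexed
  by half steps. The parameter b is the overshoot beyond the exact projection.\<close>

locale relaxed_projections =
  fixes C :: "nat \<Rightarrow> 'a::euclidean_space set" and b :: real and z :: "nat \<Rightarrow> 'a"
  assumes closed_C: "closed (C n)" and convex_C: "convex (C n)"
    and period: "C (Suc (Suc n)) = C n"
    and meets: "(\<Inter>n. C n) \<noteq> {}"
    and b: "0 \<le> b" "b < 1"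
    and z_Suc: "z (Suc n) = relaxed_proj (1 + b) (C n) (z n)"
begin

definition "w n = closest_point (C n) (z n)"
definition "t n = infdist (z n) (C n)"
text \<open>If z n already lies in \<open>C n\<close>, then \<open>sgn 0 = 0\<close> makes u n
  vanish, so \<open>z_w\<close> and \<open>z_step\<close> hold in that case too.\<close>

definition "u n = sgn (z n - w n)"

lemma nonempty: "C n \<noteq> {}"
  using meets by blast

lemma w_in: "w n \<in> C n"
  by (simp add: w_def closed_C nonempty closest_point_in_set)

lemma t_nonneg [simp]: "0 \<le> t n"
  by (simp add: t_def infdist_nonneg)

lemma t_eq: "t n = norm (z n - w n)"
  by (simp add: t_def w_def infdist_closest_point closed_C nonempty)

lemma z_w: "z n - w n = t n *\<^sub>R u n"
  by (cases "z n = w n") (simp_all add: t_eq u_def sgn_div_norm)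

lemma z_step: "z (Suc n) = z n - ((1 + b) * t n) *\<^sub>R u n"
proof -
  have "z (Suc n) = z n - (1 + b) *\<^sub>R (z n - w n)"
    by (simp add: z_Suc relaxed_proj_def w_def algebra_simps)
  then show ?thesis by (simp add: z_w)
qed

lemma dist_step: "dist (z (Suc n)) (z n) \<le> (1 + b) * t n"
  using b by (simp add: z_step dist_norm u_def norm_sgn)

lemma u_normal: "t n > 0 \<Longrightarrow> unit_normal (C n) (w n) (u n)"
  unfolding u_def w_def t_def
  by (intro unit_normal_closest_point closed_C convex_C nonempty) auto

lemma C_parity: "C n = C (n mod 2)"
  by (induction n rule: nat_induct2) (auto simp: period mod_Suc_eq)

lemma C_all: "C i = C n \<or> C i = C (Suc n)"
proof -
  have "i mod 2 = n mod 2 \<or> i mod 2 = Suc n mod 2" by presburger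
  then have "C (i mod 2) = C (n mod 2) \<or> C (i mod 2) = C (Suc n mod 2)" by (elim disjE) (simp_all only: simp_thms)
  then show ?thesis by (simp only: C_parity[symmetric])
qed

text \<open>Expand the square around p. The projection inequality bounds the mixed term, and 2 (1 +
  b) - (1 + b)^2 = 1 - b^2.\<close>

lemma fejer:
  assumes p: "\<And>n. p \<in> C n"
  shows "(norm (z (Suc n) - p))\<^sup>2 \<le> (norm (z n - p))\<^sup>2 - (1 - b\<^sup>2) * (t n)\<^sup>2"
proof -
  define e where "e = z n - w n"
  have "e \<bullet> (p - w n) \<le> 0"
    unfolding e_def w_def by (rule closest_point_dot) (auto simp: closed_C convex_C p)
  then have *: "(t n)\<^sup>2 \<le> e \<bullet> (z n - p)"
    by (simp add: t_eq power2_norm_eq_inner e_def[symmetric] inner_diff_right) (simp add: e_def inner_diff_right)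
  have eq: "z (Suc n) - p = (z n - p) - (1 + b) *\<^sub>R e" by (simp add: z_step e_def z_w)
  have "(norm (z (Suc n) - p))\<^sup>2 = (norm (z n - p))\<^sup>2 - 2 * (1 + b) * (e \<bullet> (z n - p)) + (1 + b)\<^sup>2 * (e \<bullet> e)"
    unfolding eq power2_norm_eq_inner
    by (simp only: inner_diff_left[of "z n - p" "(1 + b) *\<^sub>R e"] inner_diff_right[of _ "z n - p" "(1 + b) *\<^sub>R e"]
        inner_scaleR_left inner_scaleR_right inner_commute[of "z n - p" e])
      (simp add: power2_eq_square algebra_simps)
  also have "e \<bullet> e = (t n)\<^sup>2" by (simp add: t_eq e_def power2_norm_eq_inner)
  also have "(norm (z n - p))\<^sup>2 - 2 * (1 + b) * (e \<bullet> (z n - p)) + (1 + b)\<^sup>2 * (t n)\<^sup>2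
      \<le> (norm (z n - p))\<^sup>2 - 2 * (1 + b) * (t n)\<^sup>2 + (1 + b)\<^sup>2 * (t n)\<^sup>2"
    using * b by (simp add: mult_left_mono)
  also have "\<dots> = (norm (z n - p))\<^sup>2 - (1 - b\<^sup>2) * (t n)\<^sup>2" by (simp add: power2_eq_square algebra_simps)
  finally show ?thesis .
qed

lemma one_minus_b2: "1 - b\<^sup>2 > 0"
  using b by (simp add: power_less_one_iff)

lemma dist_antimono:
  assumes "\<And>n. p \<in> C n"
  shows "antimono (\<lambda>n. norm (z n - p))"
proof (rule decseq_SucI)
  fix n
  have "(norm (z (Suc n) - p))\<^sup>2 \<le> (norm (z n - p))\<^sup>2"
    using fejer[OF assms, of n] one_minus_b2 by (smt (verit) mult_nonneg_nonneg zero_le_power2)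
  then show "norm (z (Suc n) - p) \<le> norm (z n - p)" by (rule power2_le_imp_le) simp
qed

text \<open>Telescoping \<open>fejer\<close> makes the squared residuals summable.\<close>

lemma t_tendsto_0: "t \<longlonglongrightarrow> 0"
proof -
  obtain p where p: "\<And>n. p \<in> C n" using meets by blast
  have "(\<Sum>i<n. (1 - b\<^sup>2) * (t i)\<^sup>2) \<le> (norm (z 0 - p))\<^sup>2 - (norm (z n - p))\<^sup>2" for n
    by (induction n) (use fejer[OF p] in \<open>auto simp: algebra_simps intro: order_trans\<close>, smt (verit) fejer[OF p])
  then have "(\<Sum>i<n. (1 - b\<^sup>2) * (t i)\<^sup>2) \<le> (norm (z 0 - p))\<^sup>2" for n
    by (smt (verit) zero_le_power2)
  then have "summable (\<lambda>i. (1 - b\<^sup>2) * (t i)\<^sup>2)"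
    using one_minus_b2 by (intro summableI_nonneg_bounded[where x="(norm (z 0 - p))\<^sup>2"]) auto
  then have "(\<lambda>i. (1 - b\<^sup>2) * (t i)\<^sup>2) \<longlonglongrightarrow> 0" by (rule summable_LIMSEQ_zero)
  then have "(\<lambda>i. (t i)\<^sup>2) \<longlonglongrightarrow> 0"
    using one_minus_b2 by (simp add: tendsto_mult_left_iff[where l=0, simplified])
  then have "(\<lambda>i. sqrt ((t i)\<^sup>2)) \<longlonglongrightarrow> sqrt 0" by (rule tendsto_real_sqrt)
  then show ?thesis by simp
qed

lemma z_convergent: "\<exists>x. (\<forall>n. x \<in> C n) \<and> z \<longlonglongrightarrow> x"
proof -
  obtain p where p: "\<And>n. p \<in> C n" using meets by blast
  have "z n \<in> cball p (norm (z 0 - p))" for n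
    using dist_antimono[OF p, THEN antimonoD, of 0 n] by (simp add: dist_norm norm_minus_commute)
  then obtain x r where r: "strict_mono r" "(z \<circ> r) \<longlonglongrightarrow> x"
    using compact_cball[of p "norm (z 0 - p)"] unfolding compact_def by metis
  have x: "x \<in> C i" for i
  proof -
    \<comment> \<open>Each set is the current or the next one; in the latter case z n is compared
      with its successor, at most (1 + b) t n away.\<close>
    have bd: "infdist (z n) (C i) \<le> t n + (t (Suc n) + (1 + b) * t n)" for n
    proof (cases "C i = C n")
      case True
      then show ?thesis using b t_nonneg[of n] t_nonneg[of "Suc n"] by (simp add: t_def[symmetric] add_nonneg_nonneg)
    next
      case False
      then have "C i = C (Suc n)" using C_all by blast
      then have "infdist (z n) (C i) \<le> t (Suc n) + dist (z n) (z (Suc n))"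
        unfolding t_def using infdist_triangle by metis
      then show ?thesis using dist_step[of n] t_nonneg[of n] unfolding dist_commute[of "z n"] by linarith
    qed
    have "(\<lambda>n. t n + (t (Suc n) + (1 + b) * t n)) \<longlonglongrightarrow> 0 + (0 + (1 + b) * 0)"
      by (intro tendsto_intros t_tendsto_0 LIMSEQ_Suc)
    then have bd0: "(\<lambda>n. t n + (t (Suc n) + (1 + b) * t n)) \<longlonglongrightarrow> 0" by simp
    have "(\<lambda>n. infdist (z n) (C i)) \<longlonglongrightarrow> 0"
      by (rule tendsto_sandwich[OF _ _ tendsto_const bd0])
        (rule always_eventually, use bd infdist_nonneg in blast)+
    then have "((\<lambda>n. infdist (z n) (C i)) \<circ> r) \<longlonglongrightarrow> 0" using r(1) by (rule LIMSEQ_subseq_LIMSEQ)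
    moreover have "((\<lambda>n. infdist (z n) (C i)) \<circ> r) \<longlonglongrightarrow> infdist x (C i)"
      using tendsto_infdist[OF r(2), of "C i"] by (simp add: o_def)
    ultimately have "infdist x (C i) = 0" by (rule LIMSEQ_unique[rotated])
    then show ?thesis using in_closed_iff_infdist_zero[OF closed_C nonempty] by simp
  qed
  \<comment> \<open>Now x is a common point, so the distances to it decrease and convergence of the
    subsequence carries over.\<close>
  have "z \<longlonglongrightarrow> x"
  proof (rule LIMSEQ_I)
    fix e :: real assume e: "e > 0"
    obtain k where "norm (z (r k) - x) < e" using LIMSEQ_D[OF r(2) e] by auto
    then have "norm (z n - x) < e" if "n \<ge> r k" for n
      using dist_antimono[OF x, THEN antimonoD, OF that] by simp
    then show "\<exists>N. \<forall>n\<ge>N. norm (z n - x) < e" by blast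
  qed
  then show ?thesis using x by blast
qed

text \<open>The point w n lies in the set onto which z (n+2) is projected, so replacing w (n+2) by w
  n can only increase the inner product with the normal. Relative to w n, the first half step leaves
  -b t n u n, and the second adds -(1 + b) t (n+1) u (n+1).\<close>

lemma residual_recurrence:
  assumes "t (Suc (Suc n)) > 0"
  shows "t (Suc (Suc n)) \<le> - (1 + b) * t (Suc n) * (u (Suc (Suc n)) \<bullet> u (Suc n))
    - b * t n * (u (Suc (Suc n)) \<bullet> u n)"
proof -
  let ?n = "Suc (Suc n)"
  have un: "unit_normal (C ?n) (w ?n) (u ?n)" using u_normal assms .
  have "t ?n = u ?n \<bullet> (z ?n - w ?n)" by (simp add: t_eq u_def inner_sgn_self)
  also have "\<dots> \<le> u ?n \<bullet> (z ?n - w n)"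
    using un w_in[of n] by (simp add: unit_normal_def period inner_diff_right)
  also have "z ?n - w n = - (((1 + b) * t (Suc n)) *\<^sub>R u (Suc n)) - (b * t n) *\<^sub>R u n"
    using z_w[of n] by (simp add: z_step[of "Suc n"] z_step[of n] algebra_simps)
  finally show ?thesis by (simp only: inner_diff_right inner_minus_right inner_scaleR_right mult_minus_left)
qed

text \<open>D is the constant of the geometric tail sum. Subtracting D \<rho>^n makes the distance
  to x increasing with limit 0, hence nonpositive.\<close>

lemma dist_limit_le_geometric:
  assumes "z \<longlonglongrightarrow> x" "0 < \<rho>" "\<rho> < 1" "K \<ge> 0" "\<And>n. t n \<le> K * \<rho> ^ n"
  shows "norm (z n - x) \<le> (1 + b) * K / (1 - \<rho>) * \<rho> ^ n"
proof -
  define D where "D = (1 + b) * K / (1 - \<rho>)"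
  have D: "D * (1 - \<rho>) = (1 + b) * K" using assms(3) by (simp add: D_def)
  have "incseq (\<lambda>n. norm (z n - x) - D * \<rho> ^ n)"
  proof (rule incseq_SucI)
    fix n
    have "norm (z n - x) \<le> dist (z (Suc n)) (z n) + norm (z (Suc n) - x)"
      by (metis dist_norm dist_commute dist_triangle)
    moreover have "dist (z (Suc n)) (z n) \<le> (1 + b) * (K * \<rho> ^ n)"
      using dist_step[of n] assms(5)[of n] b by (smt (verit) mult_left_mono)
    moreover have "(1 + b) * (K * \<rho> ^ n) = D * \<rho> ^ n - D * \<rho> ^ Suc n"
      using arg_cong[OF D, of "\<lambda>x. x * \<rho> ^ n"] by (simp add: algebra_simps)
    ultimately show "norm (z n - x) - D * \<rho> ^ n \<le> norm (z (Suc n) - x) - D * \<rho> ^ Suc n" by linarith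
  qed
  moreover have "(\<lambda>n. norm (z n - x) - D * \<rho> ^ n) \<longlonglongrightarrow> norm (x - x) - D * 0"
    using assms(2,3) by (intro tendsto_intros assms(1) LIMSEQ_realpow_zero) auto
  ultimately have "norm (z n - x) - D * \<rho> ^ n \<le> 0" using incseq_le by fastforce
  then show ?thesis by (simp add: D_def)
qed

end

section \<open>Decay of the residuals near the limit: the three cases\<close>

text \<open>The vector m n is the normal at x when x is a smooth point of \<open>C n\<close>; for
  interior x it may be arbitrary.\<close>

locale relaxed_projections_limit = relaxed_projections +
  fixes x :: 'a and m :: "nat \<Rightarrow> 'a"
  assumes lim: "z \<longlonglongrightarrow> x" and x_in: "x \<in> C n"
    and m_period: "m (Suc (Suc n)) = m n"
    and smooth: "x \<in> interior (C n) \<or> smooth_point (C n) x (m n)"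
begin

lemma m_parity: "m n = m (n mod 2)"
  by (induction n rule: nat_induct2) (auto simp: m_period mod_Suc_eq)

lemma w_near:
  assumes "d > 0"
  shows "\<forall>\<^sub>F n in sequentially. dist (w n) x < d"
proof -
  have "dist (w n) x \<le> dist (z n) x" for n
    using closest_point_lipschitz[OF convex_C closed_C nonempty, of n "z n" x] closest_point_self[OF x_in[of n]]
    by (simp add: w_def)
  moreover have "\<forall>\<^sub>F n in sequentially. dist (z n) x < d" using lim assms by (rule tendstoD)
  ultimately show ?thesis by (auto elim!: eventually_mono intro: order_le_less_trans)
qed

lemma u_near:
  assumes "e > 0"
  shows "\<forall>\<^sub>F n in sequentially. t n > 0 \<longrightarrow> x \<notin> interior (C n) \<and> norm (u n - m n) < e"
proof -
  have "\<exists>d>0. \<forall>w u. dist w x < d \<longrightarrow> unit_normal (C i) w u \<longrightarrow> x \<notin> interior (C i) \<and> norm (u - m i) < e" for i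
    using smooth assms by (rule unit_normal_near_or_interior)
  then obtain d where d: "\<And>i. d i > 0" "\<And>i w u. dist w x < d i \<Longrightarrow> unit_normal (C i) w u \<Longrightarrow> x \<notin> interior (C i) \<and> norm (u - m i) < e"
    by metis
  \<comment> \<open>By periodicity two radii suffice.\<close>
  have "\<forall>\<^sub>F n in sequentially. dist (w n) x < min (d 0) (d 1)"
    using d(1) by (intro w_near) simp
  then show ?thesis
  proof (rule eventually_mono)
    fix n assume *: "dist (w n) x < min (d 0) (d 1)"
    have "n mod 2 = 0 \<or> n mod 2 = 1" by auto
    then have "dist (w n) x < d (n mod 2)" using * by auto
    then show "t n > 0 \<longrightarrow> x \<notin> interior (C n) \<and> norm (u n - m n) < e"
      using d(2)[of "w n" "n mod 2" "u n"] u_normal[of n] C_parity[of n] m_parity[of n] by simp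
  qed
qed

lemma eventually_normal:
  assumes "e > 0"
  obtains N where "\<And>n. n \<ge> N \<Longrightarrow> t n > 0 \<Longrightarrow> x \<notin> interior (C n) \<and> norm (u n - m n) < e \<and> norm (u n) = 1 \<and> norm (m n) = 1"
proof -
  obtain N where N: "\<And>n. n \<ge> N \<Longrightarrow> t n > 0 \<longrightarrow> x \<notin> interior (C n) \<and> norm (u n - m n) < e"
    using u_near[OF assms] by (auto simp: eventually_sequentially)
  have "norm (u n) = 1 \<and> norm (m n) = 1" if "n \<ge> N" "t n > 0" for n
    using N[OF that(1)] that(2) smooth[of n] u_normal[of n] by (auto simp: unit_normal_def smooth_point_def)
  then show ?thesis using N that by blast
qed

text \<open>Replacing the normals in \<open>residual_recurrence\<close> by their limits costs a
  small \<epsilon> in each coefficient; as \<rho> > \<beta>, \<open>three_term_decay\<close>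
  tolerates this.\<close>

lemma decay_acute:
  assumes \<beta>: "0 \<le> \<beta>" "b = \<beta>\<^sup>2" "\<beta> < \<rho>" and angle: "\<And>n. - (1 + b) * (m (Suc n) \<bullet> m n) \<le> 2 * \<beta>"
  shows "\<exists>K\<ge>0. \<forall>n. t n \<le> K * \<rho> ^ n"
proof -
  have \<rho>: "0 < \<rho>" using \<beta> by simp
  \<comment> \<open>The condition 2 \<beta> + \<epsilon> <= \<rho> + \<beta>^2 (1 - \<epsilon>) /
    \<rho> is equivalent to \<epsilon> (\<rho> + \<beta>^2) <= (\<rho> - \<beta>)^2.\<close>
  define \<epsilon> where "\<epsilon> = min 1 ((\<rho> - \<beta>)\<^sup>2 / (\<rho> + \<beta>\<^sup>2))"
  have pos: "\<rho> + \<beta>\<^sup>2 > 0" using \<rho> by (simp add: add_pos_nonneg)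
  have \<epsilon>: "0 < \<epsilon>" "\<epsilon> \<le> 1" "\<epsilon> * (\<rho> + \<beta>\<^sup>2) \<le> (\<rho> - \<beta>)\<^sup>2"
    using \<beta> pos by (auto simp: \<epsilon>_def min_def pos_le_divide_eq)
  \<comment> \<open>Inner products then err by at most \<epsilon>/2, and the factor 1 + b is below
    2.\<close>
  define e where "e = \<epsilon> / 4"
  have e: "e > 0" using \<epsilon> by (simp add: e_def)
  obtain N where N: "\<And>n. n \<ge> N \<Longrightarrow> t n > 0 \<Longrightarrow> x \<notin> interior (C n) \<and> norm (u n - m n) < e \<and> norm (u n) = 1 \<and> norm (m n) = 1"
    using eventually_normal[OF e] by metis
  have rec: "t (Suc (Suc n)) \<le> max 0 ((2 * \<beta> + \<epsilon>) * t (Suc n) - (b * (1 - \<epsilon>)) * t n)" if n: "n \<ge> N" for n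
  proof (cases "t (Suc (Suc n)) > 0")
    case True
    let ?u = "u (Suc (Suc n))"
    have 1: "- (1 + b) * t (Suc n) * (?u \<bullet> u (Suc n)) \<le> (2 * \<beta> + \<epsilon>) * t (Suc n)"
    \<comment> \<open>A zero residual provides no normal, but then its term vanishes.\<close>
    proof (cases "t (Suc n) > 0")
      case True
      have "\<bar>?u \<bullet> u (Suc n) - m (Suc (Suc n)) \<bullet> m (Suc n)\<bar> \<le> 2 * e"
        using N[of "Suc n"] N[of "Suc (Suc n)"] n True \<open>t (Suc (Suc n)) > 0\<close>
        by (intro inner_unit_vectors_near) auto
      then have "(1 + b) * (m (Suc (Suc n)) \<bullet> m (Suc n) - ?u \<bullet> u (Suc n)) \<le> (1 + b) * (2 * e)"
        using b by (intro mult_left_mono) auto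
      also have "\<dots> \<le> \<epsilon>" using b e by (simp add: e_def)
      finally have "- (1 + b) * (?u \<bullet> u (Suc n)) \<le> 2 * \<beta> + \<epsilon>"
        using angle[of "Suc n"] by (simp add: algebra_simps)
      then have "(- (1 + b) * (?u \<bullet> u (Suc n))) * t (Suc n) \<le> (2 * \<beta> + \<epsilon>) * t (Suc n)"
        by (rule mult_right_mono) simp
      then show ?thesis by (simp add: mult_ac)
    next
      case False
      then have "t (Suc n) = 0" using t_nonneg[of "Suc n"] by linarith
      then show ?thesis by simp
    qed
    have 2: "- b * t n * (?u \<bullet> u n) \<le> - (b * (1 - \<epsilon>)) * t n"
    proof (cases "t n > 0")
      case t: True
      have "\<bar>?u \<bullet> u n - m (Suc (Suc n)) \<bullet> m n\<bar> \<le> 2 * e"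
        using N[of n] N[of "Suc (Suc n)"] n t True by (intro inner_unit_vectors_near) auto
      moreover have "m (Suc (Suc n)) \<bullet> m n = 1" using N[OF n t] by (simp add: m_period dot_square_norm)
      ultimately have "1 - \<epsilon> \<le> ?u \<bullet> u n" using e unfolding e_def by linarith
      then have "(b * t n) * (1 - \<epsilon>) \<le> (b * t n) * (?u \<bullet> u n)" using b by (intro mult_left_mono) auto
      then show ?thesis by (simp add: mult_ac)
    next
      case False
      then have "t n = 0" using t_nonneg[of n] by linarith
      then show ?thesis by simp
    qed
    show ?thesis using residual_recurrence[OF True] 1 2 by (auto simp: le_max_iff_disj)
  qed simp
  show ?thesis
  proof (rule three_term_decay[where t=t and N=N and a="2 * \<beta> + \<epsilon>" and b="b * (1 - \<epsilon>)",
        OF t_nonneg \<rho> _ _ _ rec])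
    show "0 \<le> b * (1 - \<epsilon>)" using b \<epsilon> by simp
    have "b * (1 - \<epsilon>) \<le> \<beta>\<^sup>2" using \<epsilon> by (simp add: \<beta>(2) mult_left_le)
    also have "\<dots> < \<rho>\<^sup>2" using \<beta> by (intro power_strict_mono) auto
    finally show "b * (1 - \<epsilon>) < \<rho>\<^sup>2" .
    have "(2 * \<beta> + \<epsilon>) * \<rho> \<le> \<rho> * \<rho> + b * (1 - \<epsilon>)"
      using \<epsilon>(3) by (simp add: \<beta>(2) power2_eq_square algebra_simps)
    then show "2 * \<beta> + \<epsilon> \<le> \<rho> + b * (1 - \<epsilon>) / \<rho>" using \<rho> by (simp add: field_simps)
  qed
qed

text \<open>Half steps n and n+2 use the same set, so both normals approach one unit vector. The
  last term of \<open>residual_recurrence\<close> can then be dropped in the interior and opposite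
  cases.\<close>

lemma inner_successive_normals_nonneg:
  obtains N where "\<And>n. n \<ge> N \<Longrightarrow> t (Suc (Suc n)) > 0 \<Longrightarrow> 0 \<le> b * t n * (u (Suc (Suc n)) \<bullet> u n)"
proof -
  obtain N where N: "\<And>n. n \<ge> N \<Longrightarrow> t n > 0 \<Longrightarrow> x \<notin> interior (C n) \<and> norm (u n - m n) < 1/2 \<and> norm (u n) = 1 \<and> norm (m n) = 1"
    using eventually_normal[of "1/2"] by auto
  have "0 \<le> b * t n * (u (Suc (Suc n)) \<bullet> u n)" if n: "n \<ge> N" "t (Suc (Suc n)) > 0" for n
  proof (cases "t n > 0")
    case t: True
    have "\<bar>u (Suc (Suc n)) \<bullet> u n - m (Suc (Suc n)) \<bullet> m n\<bar> \<le> 2 * (1/2)"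
      using N[of n] N[of "Suc (Suc n)"] n t by (intro inner_unit_vectors_near) auto
    moreover have "m (Suc (Suc n)) \<bullet> m n = 1" using N[OF n(1) t] by (simp add: m_period dot_square_norm)
    ultimately show ?thesis using b by simp
  next
    case False
    then have "t n = 0" using t_nonneg[of n] by linarith
    then show ?thesis by simp
  qed
  then show ?thesis using that by blast
qed

text \<open>The residuals vanish after finitely many steps. A positive t (n+2) would put x in the
  interior of the other set, whose residual t (n+1) is then 0, and the recurrence would give t (n+2)
  <= 0.\<close>

lemma decay_interior:
  assumes "x \<in> interior (C 0) \<or> x \<in> interior (C 1)" "0 < \<rho>"
  shows "\<exists>K\<ge>0. \<forall>n. t n \<le> K * \<rho> ^ n"
proof -
  obtain N where N: "\<And>n. n \<ge> N \<Longrightarrow> t (Suc (Suc n)) > 0 \<Longrightarrow> 0 \<le> b * t n * (u (Suc (Suc n)) \<bullet> u n)"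
    using inner_successive_normals_nonneg by metis
  obtain N' where N': "\<And>n. n \<ge> N' \<Longrightarrow> t n > 0 \<Longrightarrow> x \<notin> interior (C n)"
    using u_near[OF zero_less_one] by (auto simp: eventually_sequentially)
  have rec: "t (Suc (Suc n)) \<le> max 0 (0 * t (Suc n) - 0 * t n)" if n: "n \<ge> max N N'" for n
  proof (rule ccontr)
    assume "\<not> ?thesis"
    then have pos: "t (Suc (Suc n)) > 0" by simp
    then have "x \<notin> interior (C n)" using N'[of "Suc (Suc n)"] n by (simp add: period)
    then have "x \<in> interior (C (Suc n))" using assms(1) C_all by metis
    then have "\<not> t (Suc n) > 0" using N'[of "Suc n"] n by auto
    then have "t (Suc n) = 0" using t_nonneg[of "Suc n"] by linarith
    then show False using residual_recurrence[OF pos] N[of n] n pos by simp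
  qed
  show ?thesis by (rule three_term_decay[where t=t and N="max N N'" and a=0 and b=0, OF t_nonneg assms(2) _ _ _ rec]) (use assms(2) in auto)
qed

text \<open>A projection point near x already lies in the other set, so the next residual is at most
  the overshoot b t n.\<close>

lemma decay_opposite:
  assumes opp: "\<And>i. \<exists>d>0. \<forall>w u. w \<in> C i \<longrightarrow> dist w x < d \<longrightarrow> unit_normal (C i) w u \<longrightarrow> w \<in> C (Suc i)"
    and \<rho>: "0 < \<rho>" "b \<le> \<rho>"
  shows "\<exists>K\<ge>0. \<forall>n. t n \<le> K * \<rho> ^ n"
proof -
  obtain N where N: "\<And>n. n \<ge> N \<Longrightarrow> t (Suc (Suc n)) > 0 \<Longrightarrow> 0 \<le> b * t n * (u (Suc (Suc n)) \<bullet> u n)"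
    using inner_successive_normals_nonneg by metis
  obtain d where d: "\<And>i. d i > 0" "\<And>i w u. w \<in> C i \<Longrightarrow> dist w x < d i \<Longrightarrow> unit_normal (C i) w u \<Longrightarrow> w \<in> C (Suc i)"
    using opp by metis
  have "\<forall>\<^sub>F n in sequentially. dist (w n) x < min (d 0) (d 1)"
    using d(1) by (intro w_near) simp
  then obtain N' where N': "\<And>n. n \<ge> N' \<Longrightarrow> dist (w n) x < min (d 0) (d 1)"
    by (auto simp: eventually_sequentially)
  have w_both: "w n \<in> C (Suc n)" if "n \<ge> N'" "t n > 0" for n
  proof -
    have "n mod 2 = 0 \<or> n mod 2 = 1" by auto
    then have "dist (w n) x < d (n mod 2)" using N'[OF that(1)] by auto
    then have "w n \<in> C (Suc (n mod 2))"
      using d(2)[of "w n" "n mod 2" "u n"] u_normal[OF that(2)] w_in[of n] C_parity[of n] by simp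
    also have "C (Suc (n mod 2)) = C (Suc n)"
      using C_parity[of "Suc (n mod 2)"] C_parity[of "Suc n"] by (simp add: mod_Suc_eq)
    finally show ?thesis .
  qed
  have rec: "t (Suc (Suc n)) \<le> max 0 (b * t (Suc n) - 0 * t n)" if n: "n \<ge> max N N'" for n
  proof (cases "t (Suc n) > 0")
    case True
    have "t (Suc (Suc n)) \<le> dist (z (Suc (Suc n))) (w (Suc n))"
      unfolding t_def using w_both[OF _ True] n by (intro infdist_le) auto
    also have "z (Suc (Suc n)) - w (Suc n) = - ((b * t (Suc n)) *\<^sub>R u (Suc n))"
      using z_w[of "Suc n"] by (simp add: z_step[of "Suc n"] algebra_simps)
    then have "dist (z (Suc (Suc n))) (w (Suc n)) \<le> b * t (Suc n)"
      using b by (simp add: dist_norm u_def norm_sgn)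
    finally show ?thesis by simp
  next
    case False
    \<comment> \<open>Without a normal \<open>w_both\<close> says nothing; here the recurrence
      forces t (n+2) = 0.\<close>
    then have "t (Suc n) = 0" using t_nonneg[of "Suc n"] by linarith
    then show ?thesis using residual_recurrence[of n] N[of n] n by fastforce
  qed
  show ?thesis by (rule three_term_decay[where t=t and N="max N N'" and a=b and b=0, OF t_nonneg \<rho>(1) _ _ _ rec]) (use \<rho> in auto)
qed

end

section \<open>Condition (C), the parameters, and the convergence rate\<close>

lemma condition_C_smooth:
  assumes "closed A" "convex A" "interior A \<noteq> {}" "closed B" "convex B" "interior B \<noteq> {}"
    and "condition_C A B x"
  shows "(x \<in> interior A \<or> (\<exists>n. smooth_point A x n)) \<and> (x \<in> interior B \<or> (\<exists>n. smooth_point B x n))"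
proof -
  have 1: "\<exists>n. smooth_point C x n"
    if "closed C" "convex C" "interior C \<noteq> {}" "x \<in> frontier C" "manifold_around 2 (frontier C) x" for C
    using that smooth_point_of_manifold unfolding manifold_around_def by (metis zero_less_numeral)
  have 2: "(\<exists>n. smooth_point A x n) \<and> (\<exists>n. smooth_point B x n)"
    if fr: "x \<in> frontier A" "x \<in> frontier B" and reg: "regularity_assumption (frontier A) (frontier B) x"
  proof -
    obtain k U1 S1 F1 U2 S2 F2 where "k \<ge> 2" "manifold_rep k (frontier A) x U1 S1 F1"
        "manifold_rep k (frontier B) x U2 S2 F2"
      using reg unfolding regularity_assumption_def by blast
    moreover from this have "k > 0" by simp
    ultimately show ?thesis using fr assms smooth_point_of_manifold by blast
  qed
  show ?thesis using assms(7) 1[of A] 1[of B] 2 assms unfolding condition_C_def by blast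
qed

text \<open>With \<beta> = (s - 1) / (s + 1), 1 + \<beta>^2 = 2 (s^2 + 1) / (s + 1)^2 and 2 \<beta>
  = 2 (s^2 - 1) / (s + 1)^2, so the claim is the hypothesis rearranged. Equality at the extreme
  angle explains the choice of the relaxation parameter.\<close>

lemma relaxation_angle_bound:
  fixes s c :: real
  assumes "s \<ge> 1" "2 \<le> (s\<^sup>2 + 1) * (1 + c)"
  shows "- (1 + ((s - 1) / (s + 1))\<^sup>2) * c \<le> 2 * ((s - 1) / (s + 1))"
proof -
  have p: "(s + 1)\<^sup>2 > 0" using assms(1) by simp
  have "- (1 + ((s - 1) / (s + 1))\<^sup>2) * c = 2 * (- ((s\<^sup>2 + 1) * c)) / (s + 1)\<^sup>2"
    using p by (simp add: field_simps power2_eq_square)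
  also have "\<dots> \<le> 2 * (s\<^sup>2 - 1) / (s + 1)\<^sup>2"
    using p assms(2) by (intro divide_right_mono) (auto simp: algebra_simps)
  also have "\<dots> = 2 * ((s - 1) / (s + 1))"
    using assms(1) by (simp add: divide_simps power2_eq_square) (simp add: algebra_simps)
  finally show ?thesis .
qed

theorem theorem11:
  fixes A B :: "'a::euclidean_space set" and \<kappa>h :: real and x0 :: 'a
  assumes "closed A" "convex A" "interior A \<noteq> {}"
      and "closed B" "convex B" "interior B \<noteq> {}"
      and "A \<inter> B \<noteq> {}"
      and "\<forall>xs\<in>A \<inter> B. condition_C A B xs"
      and "\<kappa>h > 0"
      and "\<forall>xs\<in>A \<inter> B. \<exists>\<delta>>0. \<forall>x\<in>cball xs \<delta>.
             infdist x (A \<inter> B) \<le> \<kappa>h * max (infdist x A) (infdist x B)"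
  shows "let \<kappa> = max \<kappa>h (sqrt 2);
             \<alpha>1 = 2 * (\<kappa> / (sqrt (\<kappa>\<^sup>2 - 1) + 1))\<^sup>2;
             \<gamma> = ((sqrt (\<kappa>\<^sup>2 - 1) - 1) / (sqrt (\<kappa>\<^sup>2 - 1) + 1))\<^sup>2;
             x = (\<lambda>k. (gap_step 1 \<alpha>1 \<alpha>1 A B ^^ k) x0)
         in \<exists>xs\<in>A \<inter> B. \<forall>\<mu>. \<gamma> < \<mu> \<and> \<mu> < 1 \<longrightarrow>
              (\<exists>C>0. \<forall>k. norm (x k - xs) \<le> C * \<mu> ^ k)"
proof -
  define \<kappa> where "\<kappa> = max \<kappa>h (sqrt 2)"
  define s where "s = sqrt (\<kappa>\<^sup>2 - 1)"
  define \<beta> where "\<beta> = (s - 1) / (s + 1)"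
  define \<alpha> where "\<alpha> = 2 * (\<kappa> / (s + 1))\<^sup>2"
  have "(sqrt 2)\<^sup>2 \<le> \<kappa>\<^sup>2" unfolding \<kappa>_def by (intro power_mono) auto
  then have \<kappa>2: "2 \<le> \<kappa>\<^sup>2" by simp
  \<comment> \<open>The lower bound sqrt 2 on \<kappa> gives s >= 1, which makes \<beta>
    nonnegative.\<close>
  then have s: "s \<ge> 1" and \<kappa>s: "\<kappa>\<^sup>2 = s\<^sup>2 + 1" by (auto simp: s_def)
  have \<beta>: "0 \<le> \<beta>" "\<beta> < 1" using s by (auto simp: \<beta>_def)
  \<comment> \<open>Both sides are 2 (s^2 + 1) / (s + 1)^2, so each projection overshoots by
    \<beta>^2 = \<gamma>.\<close>
  have \<alpha>: "\<alpha> = 1 + \<beta>\<^sup>2"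
    using s by (simp add: \<alpha>_def \<beta>_def power_divide \<kappa>s add_divide_eq_iff) (simp add: power2_eq_square algebra_simps divide_simps)
  \<comment> \<open>B has the even indices because a step of the algorithm projects onto B
    first.\<close>
  define C where "C n = (if even n then B else A)" for n :: nat
  define z where "z = rec_nat x0 (\<lambda>n y. relaxed_proj (1 + \<beta>\<^sup>2) (C n) y)"
  interpret relaxed_projections C "\<beta>\<^sup>2" z
  proof
    show "(\<Inter>n. C n) \<noteq> {}" using assms(7) by (auto simp: C_def)
    show "\<beta>\<^sup>2 < 1" using \<beta> by (simp add: power_less_one_iff)
  qed (use assms in \<open>auto simp: C_def z_def\<close>)
  have z_even: "z (2 * k) = (gap_step 1 \<alpha> \<alpha> A B ^^ k) x0" for k
  proof (induction k)
    case (Suc k)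
    have "z (2 * Suc k) = gap_step 1 \<alpha> \<alpha> A B (z (2 * k))"
      by (simp add: z_Suc C_def gap_step_def \<alpha>)
    then show ?case using Suc by simp
  qed (simp add: z_def)
  obtain x where x: "\<And>n. x \<in> C n" "z \<longlonglongrightarrow> x" using z_convergent by blast
  have xA: "x \<in> A" and xB: "x \<in> B" using x(1)[of 1] x(1)[of 0] by (auto simp: C_def)
  have "condition_C A B x" using assms(8) xA xB by blast
  then obtain nA nB where nA: "x \<in> interior A \<or> smooth_point A x nA"
    and nB: "x \<in> interior B \<or> smooth_point B x nB"
    using condition_C_smooth assms(1-6) by meson
  define m where "m n = (if even n then nB else nA)" for n :: nat
  interpret relaxed_projections_limit C "\<beta>\<^sup>2" z x m
    by unfold_locales (use x nA nB in \<open>auto simp: m_def C_def\<close>)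
  obtain \<delta> where \<delta>: "\<delta> > 0"
    "\<And>y. y \<in> cball x \<delta> \<Longrightarrow> infdist y (A \<inter> B) \<le> \<kappa>h * max (infdist y A) (infdist y B)"
    using assms(10) xA xB by blast
  have decay: "\<exists>K\<ge>0. \<forall>n. t n \<le> K * \<rho> ^ n" if \<rho>: "\<beta> < \<rho>" for \<rho>
  proof -
    have \<rho>0: "\<rho> > 0" using \<rho> \<beta> by simp
    consider (int) "x \<in> interior A \<or> x \<in> interior B"
      | (opposite) "smooth_point A x nA" "smooth_point B x nB" "nA + nB = 0"
      | (acute) "smooth_point A x nA" "smooth_point B x nB" "nA + nB \<noteq> 0"
      using nA nB by blast
    then show ?thesis
    proof cases
      case int
      then show ?thesis using \<rho>0 by (intro decay_interior) (auto simp: C_def)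
    next
      case opposite
      have AB: "\<exists>d>0. \<forall>w u. w \<in> A \<longrightarrow> dist w x < d \<longrightarrow> unit_normal A w u \<longrightarrow> w \<in> B"
        by (rule opposite_normals_frontier[OF assms(1,2) xA opposite(1) assms(4,5) xB opposite(2) assms(9) \<delta> opposite(3)])
      have BA: "\<exists>d>0. \<forall>w u. w \<in> B \<longrightarrow> dist w x < d \<longrightarrow> unit_normal B w u \<longrightarrow> w \<in> A"
      proof (rule opposite_normals_frontier[OF assms(4,5) xB opposite(2) assms(1,2) xA opposite(1) assms(9) \<delta>(1)])
        show "infdist y (B \<inter> A) \<le> \<kappa>h * max (infdist y B) (infdist y A)" if "y \<in> cball x \<delta>" for y
          using \<delta>(2)[OF that] by (simp add: Int_commute max.commute)
      qed (use opposite(3) in \<open>simp add: add.commute\<close>)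
      have "\<beta>\<^sup>2 \<le> \<rho>" using \<beta> \<rho> by (smt (verit) power2_eq_square mult_left_le)
      then show ?thesis using AB BA \<rho>0 by (intro decay_opposite) (auto simp: C_def)
    next
      case acute
      have "2 \<le> \<kappa>h\<^sup>2 * (1 + nA \<bullet> nB)"
        by (rule regularity_angle_bound[OF assms(1,2) xA acute(1) assms(4,5) xB acute(2) assms(9) \<delta> acute(3)])
      \<comment> \<open>Positivity permits replacing \<kappa>h by the larger \<kappa>.\<close>
      moreover from this have "0 < 1 + nA \<bullet> nB"
        using assms(9) by (smt (verit) mult_nonneg_nonpos zero_le_power2)
      moreover have "\<kappa>h\<^sup>2 \<le> \<kappa>\<^sup>2" using assms(9) by (intro power_mono) (auto simp: \<kappa>_def)
      ultimately have "2 \<le> (s\<^sup>2 + 1) * (1 + nA \<bullet> nB)"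
        unfolding \<kappa>s by (smt (verit) mult_right_mono)
      then have "- (1 + \<beta>\<^sup>2) * (nA \<bullet> nB) \<le> 2 * \<beta>" unfolding \<beta>_def by (rule relaxation_angle_bound[OF s])
      then show ?thesis
        using \<beta>(1) \<rho> by (intro decay_acute[of \<beta>]) (auto simp: m_def inner_commute)
    qed
  qed
  have "\<exists>K>0. \<forall>k. norm (z (2 * k) - x) \<le> K * \<mu> ^ k" if \<mu>: "\<beta>\<^sup>2 < \<mu>" "\<mu> < 1" for \<mu>
  proof -
    \<comment> \<open>\<rho> is the rate per half step, so a full step has rate \<rho>^2 =
      \<mu>.\<close>
    define \<rho> where "\<rho> = sqrt \<mu>"
    have \<rho>: "\<beta> < \<rho>" using \<mu>(1) unfolding \<rho>_def by (rule real_less_rsqrt)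
    have "\<mu> > 0" using \<mu>(1) zero_le_power2[of \<beta>] by linarith
    then have \<rho>01: "0 < \<rho>" "\<rho> < 1" "\<rho>\<^sup>2 = \<mu>" using \<mu> by (auto simp: \<rho>_def)
    obtain K where K: "K \<ge> 0" "\<And>n. t n \<le> K * \<rho> ^ n" using decay[OF \<rho>] by blast
    define D where "D = (1 + \<beta>\<^sup>2) * K / (1 - \<rho>)"
    have D: "D \<ge> 0" using K(1) \<rho>01 by (simp add: D_def)
    \<comment> \<open>D may be 0, so 1 is added to obtain a positive constant.\<close>
    have "norm (z (2 * k) - x) \<le> (D + 1) * \<mu> ^ k" for k
    proof -
      have "norm (z (2 * k) - x) \<le> D * \<rho> ^ (2 * k)"
        unfolding D_def by (rule dist_limit_le_geometric[OF x(2) \<rho>01(1,2) K])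
      also have "\<dots> \<le> (D + 1) * \<mu> ^ k"
        using \<rho>01(1,3) by (simp add: power_mult mult_right_mono flip: \<rho>01(3))
      finally show ?thesis .
    qed
    then show ?thesis using D by (intro exI[of _ "D + 1"]) auto
  qed
  then show ?thesis
    using xA xB by (auto simp: Let_def z_even \<alpha>_def \<beta>_def s_def \<kappa>_def intro!: bexI[of _ x])
qed

end
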